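(* Let $U\subset\ell_2$ be a ball with center at zero of a Banach space $\Im\subset \ell_2$, and suppose that $U$ is convex and orthosymmetric. Let $\rho_n>0$, $\rho_n\to0$, and $V_n=\{\theta\in U:\ \|\theta\|\ge\rho_n\}$. Consider, for the observations $y_j=\theta_j+\frac{\sigma}{\sqrt n}\xi_j$, $1\le j<\infty$, the problem of testing $H_0:\theta=0$ versus $H_n:\theta\in V_n$. Then there are consistent tests, i.e. there is a sequence of tests $K_n$ with $$\limsup_{n\to\infty}\bigl(\alpha(K_n)+\beta(K_n,V_n)\bigr)<1,$$ only if the set $U$ is compact (in $\ell_2$).
   Context: Here $\sigma>0$ is fixed, $\xi_j$ are i.i.d. standard normal random variables, $\theta=\{\theta_j\}_{j=1}^\infty\in\ell_2$ is unknown, and $\|\cdot\|$ is the $\ell_2$ norm. This is the sequence form of the Gaussian white noise model $dY_n(t)=f(t)dt+\frac{\sigma}{\sqrt n}dw(t)$, $t\in[0,1]$, with $\theta_j=\int f\phi_j\,dt$ the coefficients of $f$ with respect to an orthonormal system $\phi_j$. For a test $K_n=K_n(y)$, $y=\{y_j\}_{j=1}^\infty$, $\alpha(K_n)$ is its type I error probability (under $\theta=0$), $\beta(K_n,\theta)$ its type II error probability at $\theta$, and $\beta(K_n,V_n)=\sup\{\beta(K_n,\theta):\theta\in V_n\}$. A set $U\subset\ell_2$ is orthosymmetric if $\theta=\{\theta_j\}_{j=1}^\infty\in U$ and $|\eta_j|\le|\theta_j|$ for all $j$ imply $\eta=\{\eta_j\}_{j=1}^\infty\in U$.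
   Formalization: "Compact (in ℓ2)" is proved as relatively compact (the closure of U in ℓ2 is compact), with U a closed ball, since a ball of a Banach space in ℓ2 need not be closed in ℓ2; if U is closed in ℓ2 this is compactness of U. *)

theory Defs
  imports "HOL-Probability.Probability"
begin

typedef ell2 = "{x :: nat \<Rightarrow> real. summable (\<lambda>j. (x j)\<^sup>2)}"
  morphisms coord Abs_ell2
  by (rule exI[of _ "\<lambda>_. 0"]) simp

setup_lifting type_definition_ell2

lemma summable_coord_sq: "summable (\<lambda>j. (coord x j)\<^sup>2)"
  using coord[of x] by simp

lemma summable_mult_of_sq:
  fixes a b :: "nat \<Rightarrow> real"
  assumes "summable (\<lambda>j. (a j)\<^sup>2)" and "summable (\<lambda>j. (b j)\<^sup>2)"
  shows "summable (\<lambda>j. a j * b j)"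
proof (rule summable_comparison_test'[where N = 0])
  show "summable (\<lambda>j. (a j)\<^sup>2 + (b j)\<^sup>2)"
    using assms by (rule summable_add)
  fix j
  have "0 \<le> (\<bar>a j\<bar> - \<bar>b j\<bar>)\<^sup>2"
    by simp
  then have "2 * (\<bar>a j\<bar> * \<bar>b j\<bar>) \<le> (a j)\<^sup>2 + (b j)\<^sup>2"
    by (simp add: power2_diff)
  moreover have "0 \<le> \<bar>a j\<bar> * \<bar>b j\<bar>"
    by simp
  ultimately show "norm (a j * b j) \<le> (a j)\<^sup>2 + (b j)\<^sup>2"
    unfolding real_norm_def abs_mult by linarith
qed

lemma summable_sq_add:
  fixes a b :: "nat \<Rightarrow> real"
  assumes "summable (\<lambda>j. (a j)\<^sup>2)" and "summable (\<lambda>j. (b j)\<^sup>2)"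
  shows "summable (\<lambda>j. (a j + b j)\<^sup>2)"
  using summable_add[OF summable_add[OF assms] summable_mult[OF summable_mult_of_sq[OF assms], of 2]]
  by (simp add: power2_sum mult.assoc)

lemma summable_coord_mult: "summable (\<lambda>j. coord x j * coord y j)"
  by (rule summable_mult_of_sq[OF summable_coord_sq summable_coord_sq])

instantiation ell2 :: real_vector
begin

lift_definition zero_ell2 :: ell2 is "\<lambda>_. 0"
  by simp

lift_definition plus_ell2 :: "ell2 \<Rightarrow> ell2 \<Rightarrow> ell2" is "\<lambda>x y j. x j + y j"
  by (rule summable_sq_add)

lift_definition uminus_ell2 :: "ell2 \<Rightarrow> ell2" is "\<lambda>x j. - x j"
  by simp

lift_definition minus_ell2 :: "ell2 \<Rightarrow> ell2 \<Rightarrow> ell2" is "\<lambda>x y j. x j - y j"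
  using summable_sq_add[of _ "\<lambda>j. - _ j"] by simp

lift_definition scaleR_ell2 :: "real \<Rightarrow> ell2 \<Rightarrow> ell2" is "\<lambda>c x j. c * x j"
  by (simp add: power_mult_distrib summable_mult)

instance
  by standard (transfer; simp add: algebra_simps fun_eq_iff)+

end

instantiation ell2 :: real_inner
begin

definition inner_ell2 :: "ell2 \<Rightarrow> ell2 \<Rightarrow> real"
  where "inner_ell2 x y = (\<Sum>j. coord x j * coord y j)"

definition norm_ell2 :: "ell2 \<Rightarrow> real"
  where "norm_ell2 x = sqrt (\<Sum>j. (coord x j)\<^sup>2)"

definition sgn_ell2 :: "ell2 \<Rightarrow> ell2"
  where "sgn_ell2 x = x /\<^sub>R norm x"

definition dist_ell2 :: "ell2 \<Rightarrow> ell2 \<Rightarrow> real"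
  where "dist_ell2 x y = norm (x - y)"

definition uniformity_ell2 :: "(ell2 \<times> ell2) filter"
  where "uniformity_ell2 = (INF e\<in>{0<..}. principal {(x, y). dist x y < e})"

definition open_ell2 :: "ell2 set \<Rightarrow> bool"
  where "open_ell2 U \<longleftrightarrow> (\<forall>x\<in>U. eventually (\<lambda>(x', y). x' = x \<longrightarrow> y \<in> U) uniformity)"

instance
proof
  fix x y z :: ell2 and c :: real and U :: "ell2 set"
  show "dist x y = norm (x - y)"
    by (rule dist_ell2_def)
  show "sgn x = x /\<^sub>R norm x"
    by (rule sgn_ell2_def)
  show "uniformity = (INF e\<in>{0<..}. principal {(x::ell2, y). dist x y < e})"
    by (rule uniformity_ell2_def)
  show "open U \<longleftrightarrow> (\<forall>x\<in>U. eventually (\<lambda>(x', y). x' = x \<longrightarrow> y \<in> U) uniformity)"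
    by (rule open_ell2_def)
  show "inner x y = inner y x"
    by (simp add: inner_ell2_def mult.commute)
  show "inner (x + y) z = inner x z + inner y z"
    by (simp add: inner_ell2_def plus_ell2.rep_eq distrib_right suminf_add summable_coord_mult)
  show "inner (c *\<^sub>R x) y = c * inner x y"
    by (simp add: inner_ell2_def scaleR_ell2.rep_eq mult.assoc suminf_mult summable_coord_mult)
  show "0 \<le> inner x x"
    by (simp add: inner_ell2_def suminf_nonneg summable_coord_mult)
  have "inner x x = 0 \<longleftrightarrow> (\<forall>j. coord x j * coord x j = 0)"
    unfolding inner_ell2_def by (rule suminf_eq_zero_iff[OF summable_coord_mult]) simp
  also have "\<dots> \<longleftrightarrow> x = 0"
    by (auto simp: coord_inject[symmetric] zero_ell2.rep_eq fun_eq_iff)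
  finally show "inner x x = 0 \<longleftrightarrow> x = 0" .
  show "norm x = sqrt (inner x x)"
    by (simp add: norm_ell2_def inner_ell2_def power2_eq_square)
qed

end

definition orthosymmetric :: "ell2 set \<Rightarrow> bool" where
  "orthosymmetric U \<longleftrightarrow>
    (\<forall>\<theta> \<eta>. \<theta> \<in> U \<longrightarrow> (\<forall>j. \<bar>coord \<eta> j\<bar> \<le> \<bar>coord \<theta> j\<bar>) \<longrightarrow> \<eta> \<in> U)"

(* A Banach space contained in a vector space: a linear subspace S that is complete for
   its own norm N, which is unrelated to any norm of the ambient type; in particular
   continuity of the embedding is not part of the definition. *)
definition banach_space_on :: "'a::real_vector set \<Rightarrow> ('a \<Rightarrow> real) \<Rightarrow> bool" where
  "banach_space_on S N \<longleftrightarrow>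
    subspace S \<and>
    (\<forall>x\<in>S. 0 \<le> N x) \<and>
    (\<forall>x\<in>S. N x = 0 \<longleftrightarrow> x = 0) \<and>
    (\<forall>x\<in>S. \<forall>c. N (c *\<^sub>R x) = \<bar>c\<bar> * N x) \<and>
    (\<forall>x\<in>S. \<forall>y\<in>S. N (x + y) \<le> N x + N y) \<and>
    (\<forall>X. (\<forall>k. X k \<in> S) \<longrightarrow>
         (\<forall>e>0. \<exists>m. \<forall>k\<ge>m. \<forall>l\<ge>m. N (X k - X l) < e) \<longrightarrow>
         (\<exists>x\<in>S. (\<lambda>k. N (X k - x)) \<longlonglongrightarrow> 0))"

definition observation ::
  "(nat \<Rightarrow> 'w \<Rightarrow> real) \<Rightarrow> real \<Rightarrow> nat \<Rightarrow> ell2 \<Rightarrow> 'w \<Rightarrow> (nat \<Rightarrow> real)" where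
  "observation \<xi> \<sigma> n \<theta> = (\<lambda>\<omega> j. coord \<theta> j + \<sigma> / sqrt (real n) * \<xi> j \<omega>)"

(* Tests may be randomized: K y is the probability of rejecting the null hypothesis at y. *)
definition is_test :: "((nat \<Rightarrow> real) \<Rightarrow> real) \<Rightarrow> bool" where
  "is_test K \<longleftrightarrow> K \<in> borel_measurable (PiM UNIV (\<lambda>_. borel)) \<and> (\<forall>y. 0 \<le> K y \<and> K y \<le> 1)"

definition type1_error ::
  "'w measure \<Rightarrow> (nat \<Rightarrow> 'w \<Rightarrow> real) \<Rightarrow> real \<Rightarrow> nat \<Rightarrow> ((nat \<Rightarrow> real) \<Rightarrow> real) \<Rightarrow> real" where
  "type1_error M \<xi> \<sigma> n K = (\<integral>\<omega>. K (observation \<xi> \<sigma> n 0 \<omega>) \<partial>M)"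

definition type2_error ::
  "'w measure \<Rightarrow> (nat \<Rightarrow> 'w \<Rightarrow> real) \<Rightarrow> real \<Rightarrow> nat \<Rightarrow> ((nat \<Rightarrow> real) \<Rightarrow> real) \<Rightarrow> ell2 \<Rightarrow> real" where
  "type2_error M \<xi> \<sigma> n K \<theta> = (\<integral>\<omega>. 1 - K (observation \<xi> \<sigma> n \<theta> \<omega>) \<partial>M)"

(* Taking the supremum in ennreal makes it 0 when V is empty. *)
definition sup_type2_error ::
  "'w measure \<Rightarrow> (nat \<Rightarrow> 'w \<Rightarrow> real) \<Rightarrow> real \<Rightarrow> nat \<Rightarrow> ((nat \<Rightarrow> real) \<Rightarrow> real) \<Rightarrow> ell2 set \<Rightarrow> ennreal"
  where
  "sup_type2_error M \<xi> \<sigma> n K V = (SUP \<theta>\<in>V. ennreal (type2_error M \<xi> \<sigma> n K \<theta>))"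

definition alternatives :: "ell2 set \<Rightarrow> (nat \<Rightarrow> real) \<Rightarrow> nat \<Rightarrow> ell2 set" where
  "alternatives U \<rho> n = {\<theta> \<in> U. \<rho> n \<le> norm \<theta>}"

definition consistent_tests_exist ::
  "'w measure \<Rightarrow> (nat \<Rightarrow> 'w \<Rightarrow> real) \<Rightarrow> real \<Rightarrow> (nat \<Rightarrow> ell2 set) \<Rightarrow> bool" where
  "consistent_tests_exist M \<xi> \<sigma> V \<longleftrightarrow>
    (\<exists>K. (\<forall>n\<ge>1. is_test (K n)) \<and>
         limsup (\<lambda>n. ennreal (type1_error M \<xi> \<sigma> n (K n)) + sup_type2_error M \<xi> \<sigma> n (K n) (V n)) < 1)"

(* "Compact" has to be read as relatively compact in ell2. A closed ball of a Banach space
   contained in ell2 need not be closed in ell2: in {\<theta>. 2^j * \<theta>_j tends to 0} with norm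
   sup_j 2^j * |\<theta>_j|, the closed unit ball is convex and orthosymmetric, and consistent
   tests exist if \<rho> n tends to 0 slowly, but the ball is only a dense proper subset of the
   compact box {\<theta>. |\<theta>_j| <= 2^(-j) for all j}. If U is closed in ell2, this is compactness
   of U itself. *)
definition relatively_compact :: "'a::topological_space set \<Rightarrow> bool" where
  "relatively_compact U \<longleftrightarrow> compact (closure U)"

end

theory Submission
  imports Defs
begin

text \<open>
  If \<open>U\<close> is not relatively compact, then, its coordinates being bounded, the tails
  \<open>\<Sum>j\<ge>m. (\<theta> j)\<^sup>2\<close> are not uniformly small on \<open>U\<close>. By orthosymmetry
  \<open>U\<close> then contains infinitely many vectors of the same norm \<open>sqrt e\<close> with finite,
  pairwise disjoint supports. For fixed \<open>n\<close> the centred likelihood ratios of the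
  corresponding Gaussian shifts against the null hypothesis are orthogonal in
  \<open>L\<^sup>2\<close> with a common norm, so by Bessel's inequality every test has, under some of these
  shifts, almost the same rejection probability as under the null hypothesis. As soon as
  \<open>\<rho> n \<le> sqrt e\<close>, the sum of the errors is therefore at least 1.
\<close>

section \<open>Gaussian product measure and the Cameron-Martin formula for finitely supported
  shifts\<close>

abbreviation gauss :: "real measure" where
  "gauss \<equiv> density lborel (\<lambda>x. ennreal (std_normal_density x))"

abbreviation gauss_seq :: "(nat \<Rightarrow> real) measure" where
  "gauss_seq \<equiv> PiM UNIV (\<lambda>_. gauss)"

abbreviation seq_borel :: "(nat \<Rightarrow> real) measure" where
  "seq_borel \<equiv> PiM UNIV (\<lambda>_. borel)"

lemma prob_space_gauss: "prob_space gauss"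
  using prob_space_normal_density[of 1 0] by simp

lemma prob_space_gauss_seq: "prob_space gauss_seq"
  by (rule prob_space_PiM) (rule prob_space_gauss)

lemma sets_gauss_seq [measurable_cong]: "sets gauss_seq = sets seq_borel"
  by (rule sets_PiM_cong) simp_all

lemma space_gauss_seq [simp]: "space gauss_seq = UNIV"
  by (simp add: space_PiM)

text \<open>Completing the square: after translating the Lebesgue integral by \<open>c\<close>, the
  exponential factor times the density at \<open>t + c\<close> is the density at
  \<open>t\<close>.\<close>

lemma gauss_shift:
  assumes [measurable]: "f \<in> borel_measurable borel"
  shows "(\<integral>\<^sup>+t. f (t + c) \<partial>gauss) = (\<integral>\<^sup>+t. ennreal (exp (c * t - c\<^sup>2 / 2)) * f t \<partial>gauss)"
proof -
  have *: "std_normal_density (t + c) * exp (c * (t + c) - c\<^sup>2 / 2) = std_normal_density t" for t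
    by (simp add: std_normal_density_def mult_exp_exp) (simp add: power2_eq_square field_simps)
  have "(\<integral>\<^sup>+t. ennreal (exp (c * t - c\<^sup>2 / 2)) * f t \<partial>gauss)
      = (\<integral>\<^sup>+t. ennreal (std_normal_density t) * (ennreal (exp (c * t - c\<^sup>2 / 2)) * f t) \<partial>lborel)"
    by (rule nn_integral_density) simp_all
  also have "\<dots> = (\<integral>\<^sup>+t. ennreal (std_normal_density (t + c)) *
      (ennreal (exp (c * (t + c) - c\<^sup>2 / 2)) * f (t + c)) \<partial>lborel)"
    by (subst nn_integral_real_affine[where c = 1 and t = c]) (simp_all add: add.commute)
  also have "\<dots> = (\<integral>\<^sup>+t. ennreal (std_normal_density t) * f (t + c) \<partial>lborel)"
    by (simp add: mult.assoc[symmetric] ennreal_mult[symmetric] *)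
  also have "\<dots> = (\<integral>\<^sup>+t. f (t + c) \<partial>gauss)"
    by (rule nn_integral_density[symmetric]) simp_all
  finally show ?thesis ..
qed

lemma measurable_fun_upd_seq [measurable (raw)]:
  assumes "X \<in> A \<rightarrow>\<^sub>M seq_borel" and "g \<in> borel_measurable A"
  shows "(\<lambda>p. (X p)(b := g p)) \<in> A \<rightarrow>\<^sub>M seq_borel"
  using assms by (intro measurable_fun_upd[where J = UNIV]) simp_all

text \<open>Overwriting coordinate \<open>b\<close> with an independent standard normal does not
  change the law of the sequence. This isolates one coordinate while keeping the index set
  \<open>UNIV\<close>.\<close>

lemma nn_integral_gauss_seq_split:
  assumes f[measurable]: "f \<in> borel_measurable seq_borel"
  shows "(\<integral>\<^sup>+x. f x \<partial>gauss_seq) = (\<integral>\<^sup>+x. \<integral>\<^sup>+t. f (x(b := t)) \<partial>gauss \<partial>gauss_seq)"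
proof -
  interpret g: prob_space gauss by (rule prob_space_gauss)
  interpret G: prob_space gauss_seq by (rule prob_space_gauss_seq)
  interpret pair_sigma_finite gauss gauss_seq ..
  have [measurable]: "f \<in> borel_measurable gauss_seq"
    using f by (simp add: measurable_cong_sets[OF sets_gauss_seq refl])
  have [measurable]: "(\<lambda>(t, x). x(b := t)) \<in> gauss \<Otimes>\<^sub>M gauss_seq \<rightarrow>\<^sub>M gauss_seq"
    unfolding split_def by measurable
  have "(\<integral>\<^sup>+x. f x \<partial>gauss_seq)
      = (\<integral>\<^sup>+x. f x \<partial>distr (gauss \<Otimes>\<^sub>M gauss_seq) gauss_seq (\<lambda>(t, x). x(b := t)))"
    using distr_pair_PiM_eq_PiM[of UNIV "\<lambda>_. gauss" b] prob_space_gauss by simp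
  also have "\<dots> = (\<integral>\<^sup>+p. f ((snd p)(b := fst p)) \<partial>(gauss \<Otimes>\<^sub>M gauss_seq))"
    by (subst nn_integral_distr) (simp_all add: split_def)
  also have "\<dots> = (\<integral>\<^sup>+x. \<integral>\<^sup>+t. f (x(b := t)) \<partial>gauss \<partial>gauss_seq)"
    by (subst nn_integral_snd[symmetric]) simp_all
  finally show ?thesis .
qed

text \<open>Resample coordinate \<open>b\<close> on both sides; \<open>gauss_shift\<close> then
  applies to the inner integral with all other coordinates frozen.\<close>

lemma gauss_seq_shift_coordinate:
  assumes f[measurable]: "f \<in> borel_measurable seq_borel"
  shows "(\<integral>\<^sup>+x. f (x(b := x b + c)) \<partial>gauss_seq)
    = (\<integral>\<^sup>+x. ennreal (exp (c * x b - c\<^sup>2 / 2)) * f x \<partial>gauss_seq)"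
proof -
  have [measurable]: "(\<lambda>t. f (x(b := t))) \<in> borel_measurable borel" for x
    by (rule measurable_compose[OF measurable_fun_upd_seq f]) (simp_all add: space_PiM)
  have "(\<integral>\<^sup>+x. f (x(b := x b + c)) \<partial>gauss_seq) = (\<integral>\<^sup>+x. \<integral>\<^sup>+t. f (x(b := t + c)) \<partial>gauss \<partial>gauss_seq)"
    by (subst nn_integral_gauss_seq_split[where b = b]) simp_all
  also have "\<dots> = (\<integral>\<^sup>+x. \<integral>\<^sup>+t. ennreal (exp (c * t - c\<^sup>2 / 2)) * f (x(b := t)) \<partial>gauss \<partial>gauss_seq)"
    by (subst gauss_shift) simp_all
  also have "\<dots> = (\<integral>\<^sup>+x. ennreal (exp (c * x b - c\<^sup>2 / 2)) * f x \<partial>gauss_seq)"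
    by (subst (2) nn_integral_gauss_seq_split[where b = b]) simp_all
  finally show ?thesis .
qed

text \<open>The density of the law of \<open>x + h\<close> with respect to \<open>gauss_seq\<close>
  when \<open>h\<close> vanishes off the finite set \<open>B\<close>.\<close>

definition likelihood_ratio :: "nat set \<Rightarrow> (nat \<Rightarrow> real) \<Rightarrow> (nat \<Rightarrow> real) \<Rightarrow> real" where
  "likelihood_ratio B h x = exp (\<Sum>j\<in>B. h j * x j - (h j)\<^sup>2 / 2)"

lemma measurable_likelihood_ratio [measurable]: "likelihood_ratio B h \<in> borel_measurable seq_borel"
  unfolding likelihood_ratio_def[abs_def] by measurable

lemma likelihood_ratio_pos: "likelihood_ratio B h x > 0"
  by (simp add: likelihood_ratio_def)

lemma measurable_shift_seq [measurable]: "(\<lambda>x j. x j + h j) \<in> seq_borel \<rightarrow>\<^sub>M seq_borel"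
  by (rule measurable_PiM_single') (simp_all add: space_PiM)

text \<open>One coordinate is shifted at a time, by induction on the support of
  \<open>h\<close>.\<close>

lemma cameron_martin:
  assumes "finite B" "\<And>j. j \<notin> B \<Longrightarrow> h j = 0" and "f \<in> borel_measurable seq_borel"
  shows "(\<integral>\<^sup>+x. f (\<lambda>j. x j + h j) \<partial>gauss_seq)
    = (\<integral>\<^sup>+x. ennreal (likelihood_ratio B h x) * f x \<partial>gauss_seq)"
  using assms
proof (induction B arbitrary: h f rule: finite_induct)
  case empty
  then show ?case by (simp add: likelihood_ratio_def)
next
  case (insert b B)
  note [measurable] = insert.prems(2)
  define k where "k = h(b := 0)"
  \<comment> \<open>As \<open>b\<close> is not in \<open>B\<close>, this ratio sees neither
    \<open>x b\<close> nor \<open>h b\<close>. It can therefore be moved inside the shift of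
    coordinate \<open>b\<close> below.\<close>
  have k: "likelihood_ratio B h (x(b := t)) = likelihood_ratio B k x" for x t
    unfolding likelihood_ratio_def
    by (intro arg_cong[where f = exp] sum.cong) (use insert.hyps in \<open>auto simp: k_def\<close>)
  have split: "exp (h b * x b - (h b)\<^sup>2 / 2) * likelihood_ratio B h x = likelihood_ratio (insert b B) h x" for x
    using insert.hyps by (simp add: likelihood_ratio_def exp_add)
  have "(\<lambda>j. x j + h j) = (\<lambda>j. x j + k j)(b := (x b + k b) + h b)" for x
    by (auto simp: k_def)
  then have "(\<integral>\<^sup>+x. f (\<lambda>j. x j + h j) \<partial>gauss_seq)
      = (\<integral>\<^sup>+x. (\<lambda>x. f (x(b := x b + h b))) (\<lambda>j. x j + k j) \<partial>gauss_seq)"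
    by simp
  also have "\<dots> = (\<integral>\<^sup>+x. ennreal (likelihood_ratio B k x) * f (x(b := x b + h b)) \<partial>gauss_seq)"
  proof (rule insert.IH)
    show "k j = 0" if "j \<notin> B" for j
      using insert.prems(1)[of j] that by (auto simp: k_def)
  qed measurable
  also have "\<dots> = (\<integral>\<^sup>+x. (\<lambda>x. ennreal (likelihood_ratio B h x) * f x) (x(b := x b + h b)) \<partial>gauss_seq)"
    by (simp only: k)
  also have "\<dots> = (\<integral>\<^sup>+x. ennreal (exp (h b * x b - (h b)\<^sup>2 / 2)) *
      (ennreal (likelihood_ratio B h x) * f x) \<partial>gauss_seq)"
    by (rule gauss_seq_shift_coordinate) simp
  also have "\<dots> = (\<integral>\<^sup>+x. ennreal (likelihood_ratio (insert b B) h x) * f x \<partial>gauss_seq)"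
    by (simp add: mult.assoc[symmetric] ennreal_mult[symmetric] split less_imp_le[OF likelihood_ratio_pos])
  finally show ?case .
qed

section \<open>First and second moments of likelihood ratios\<close>

lemma likelihood_ratio_shift:
  "likelihood_ratio B h (\<lambda>j. x j + k j) = exp (\<Sum>j\<in>B. h j * k j) * likelihood_ratio B h x"
  by (simp add: likelihood_ratio_def exp_add[symmetric] sum.distrib[symmetric] algebra_simps)

lemma nn_integral_likelihood_ratio:
  assumes "finite B" "\<And>j. j \<notin> B \<Longrightarrow> h j = 0"
  shows "(\<integral>\<^sup>+x. ennreal (likelihood_ratio B h x) \<partial>gauss_seq) = 1"
  using cameron_martin[OF assms, where f = "\<lambda>_. 1"] prob_space.emeasure_space_1[OF prob_space_gauss_seq]
  by simp

lemma likelihood_ratio_has_integral: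
  assumes "finite B" "\<And>j. j \<notin> B \<Longrightarrow> h j = 0"
  shows "has_bochner_integral gauss_seq (likelihood_ratio B h) 1"
  by (rule has_bochner_integral_nn_integral)
    (simp_all add: nn_integral_likelihood_ratio[OF assms] less_imp_le[OF likelihood_ratio_pos])

text \<open>Read the first ratio as the density of a shift by \<open>h\<close>. The second ratio,
  evaluated at the shifted point, only gains a constant factor, and its own integral is 1. For
  disjoint supports the result is \<open>exp 0 = 1\<close>.\<close>

lemma likelihood_ratio_mult_has_integral:
  assumes "finite B" "\<And>j. j \<notin> B \<Longrightarrow> h j = 0" and "finite A" "\<And>j. j \<notin> A \<Longrightarrow> k j = 0"
  shows "has_bochner_integral gauss_seq (\<lambda>x. likelihood_ratio B h x * likelihood_ratio A k x)
    (exp (\<Sum>j\<in>A. k j * h j))"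
proof (rule has_bochner_integral_nn_integral)
  have "(\<integral>\<^sup>+x. ennreal (likelihood_ratio B h x * likelihood_ratio A k x) \<partial>gauss_seq)
      = (\<integral>\<^sup>+x. ennreal (likelihood_ratio A k (\<lambda>j. x j + h j)) \<partial>gauss_seq)"
    by (subst cameron_martin[OF assms(1,2)])
      (simp_all add: ennreal_mult less_imp_le[OF likelihood_ratio_pos])
  also have "\<dots> = (\<integral>\<^sup>+x. ennreal (exp (\<Sum>j\<in>A. k j * h j)) * ennreal (likelihood_ratio A k x) \<partial>gauss_seq)"
    by (simp add: likelihood_ratio_shift ennreal_mult less_imp_le[OF likelihood_ratio_pos])
  also have "\<dots> = ennreal (exp (\<Sum>j\<in>A. k j * h j))"
    by (simp add: nn_integral_cmult nn_integral_likelihood_ratio[OF assms(3,4)])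
  finally show "(\<integral>\<^sup>+x. ennreal (likelihood_ratio B h x * likelihood_ratio A k x) \<partial>gauss_seq)
      = ennreal (exp (\<Sum>j\<in>A. k j * h j))" .
qed (simp_all add: less_imp_le[OF likelihood_ratio_pos])

lemma integral_gauss_seq_shift:
  assumes "finite B" "\<And>j. j \<notin> B \<Longrightarrow> h j = 0"
    and [measurable]: "g \<in> borel_measurable seq_borel" and nonneg: "\<And>x. 0 \<le> g x"
  shows "(\<integral>x. g (\<lambda>j. x j + h j) \<partial>gauss_seq) = (\<integral>x. likelihood_ratio B h x * g x \<partial>gauss_seq)"
  using cameron_martin[OF assms(1,2), where f = "\<lambda>x. ennreal (g x)"] nonneg
  by (simp add: integral_eq_nn_integral ennreal_mult less_imp_le[OF likelihood_ratio_pos])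

section \<open>Bessel's inequality and the rejection probability under shifts\<close>

lemma integrable_test_mult:
  fixes f g :: "'a \<Rightarrow> real"
  assumes f: "integrable M f" and "g \<in> borel_measurable M" and g: "\<And>x. 0 \<le> g x" "\<And>x. g x \<le> 1"
  shows "integrable M (\<lambda>x. g x * f x)"
proof (rule Bochner_Integration.integrable_bound[OF f])
  show "AE x in M. norm (g x * f x) \<le> norm (f x)"
    using g by (intro always_eventually allI) (simp add: abs_mult mult_left_le_one_le)
qed (use assms(2) borel_measurable_integrable[OF f] in measurable)

text \<open>A function with values in [0, 1] has L2 norm at most 1, so it cannot correlate by more
  than \<delta> with every member of an infinite orthogonal family of common squared norm
  \<open>C\<close>.\<close>

lemma (in prob_space) ex_small_correlation_of_orthogonal:
  fixes D :: "nat \<Rightarrow> 'a \<Rightarrow> real"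
  assumes int: "\<And>i. integrable M (D i)"
    and orth: "\<And>i k. has_bochner_integral M (\<lambda>x. D i x * D k x) (if i = k then C else 0)"
    and [measurable]: "g \<in> borel_measurable M" and g: "\<And>x. 0 \<le> g x" "\<And>x. g x \<le> 1"
    and "\<delta> > 0"
  shows "\<exists>i. (\<integral>x. g x * D i x \<partial>M) \<le> \<delta>"
proof (rule ccontr)
  assume "\<not> ?thesis"
  then have big: "\<delta> < (\<integral>x. g x * D i x \<partial>M)" for i
    by (simp add: not_le)
  have C: "C \<ge> 0"
    using has_bochner_integral_integral_eq[OF orth[of 0 0]] Bochner_Integration.integral_nonneg[of M "\<lambda>x. D 0 x * D 0 x"]
    by simp
  \<comment> \<open>With \<open>t * C \<le> \<delta>\<close> the quadratic term of the expanded
    square is at most half the linear one, which leaves the upper bound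
    \<open>1 - m * (t * \<delta>)\<close>. The summand 1 in the denominator covers
    \<open>C = 0\<close>; \<open>m\<close> is then chosen to make this bound negative.\<close>
  define t where "t = \<delta> / (C + 1)"
  have t: "t > 0" "t * C \<le> \<delta>"
    using C \<open>\<delta> > 0\<close> by (simp_all add: t_def field_simps)
  obtain m :: nat where m: "1 < m * (t * \<delta>)"
    using reals_Archimedean3[of "t * \<delta>"] t(1) \<open>\<delta> > 0\<close> by (metis mult_pos_pos)
  have intg: "integrable M (\<lambda>x. g x * D i x)" for i
    by (rule integrable_test_mult[where g = g, OF int _ g]) simp
  have intg2: "integrable M (\<lambda>x. (g x)\<^sup>2)"
    by (rule integrable_const_bound[where B = 1]) (use g in \<open>simp_all add: power_le_one\<close>)
  have expand: "(g x - t * (\<Sum>i<m. D i x))\<^sup>2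
      = (g x)\<^sup>2 - 2 * t * (\<Sum>i<m. g x * D i x) + t\<^sup>2 * (\<Sum>i<m. \<Sum>k<m. D i x * D k x)" for x
  proof -
    have "(\<Sum>i<m. \<Sum>k<m. D i x * D k x) = (\<Sum>i<m. D i x)\<^sup>2"
      by (simp add: power2_eq_square sum_product)
    moreover have "(\<Sum>i<m. g x * D i x) = g x * (\<Sum>i<m. D i x)"
      by (rule sum_distrib_left[symmetric])
    ultimately show ?thesis
      by (simp only:) (simp add: power2_eq_square algebra_simps)
  qed
  txt \<open>Bessel: the left-hand side is nonnegative, while the right-hand side becomes negative for large \<open>m\<close>.\<close>
  have "(\<integral>x. (g x - t * (\<Sum>i<m. D i x))\<^sup>2 \<partial>M)
      = (\<integral>x. (g x)\<^sup>2 \<partial>M) - 2 * t * (\<Sum>i<m. \<integral>x. g x * D i x \<partial>M)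
        + t\<^sup>2 * (\<Sum>i<m. \<Sum>k<m. \<integral>x. D i x * D k x \<partial>M)"
    unfolding expand
    using intg intg2 has_bochner_integral_iff[THEN iffD1, OF orth]
    by (simp add: Bochner_Integration.integral_sum Bochner_Integration.integrable_sum)
  also have "(\<Sum>i<m. \<Sum>k<m. \<integral>x. D i x * D k x \<partial>M) = m * C"
    using has_bochner_integral_integral_eq[OF orth] by (simp add: sum.delta)
  finally have "(\<integral>x. (g x - t * (\<Sum>i<m. D i x))\<^sup>2 \<partial>M)
      = (\<integral>x. (g x)\<^sup>2 \<partial>M) - 2 * t * (\<Sum>i<m. \<integral>x. g x * D i x \<partial>M) + t\<^sup>2 * (m * C)" .
  moreover have "(\<integral>x. (g x)\<^sup>2 \<partial>M) \<le> 1"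
    using integral_mono[OF intg2, of "\<lambda>_. 1"] g prob_space by (simp add: power_le_one)
  moreover have "2 * t * (m * \<delta>) \<le> 2 * t * (\<Sum>i<m. \<integral>x. g x * D i x \<partial>M)"
    using t(1) sum_mono[of "{..<m}" "\<lambda>_. \<delta>" "\<lambda>i. \<integral>x. g x * D i x \<partial>M"] big
    by (intro mult_left_mono) (simp_all add: less_imp_le)
  moreover have "t\<^sup>2 * (m * C) \<le> t * (m * \<delta>)"
    using mult_left_mono[OF t(2), of "t * m"] t(1) by (simp add: power2_eq_square mult_ac)
  moreover have "0 \<le> (\<integral>x. (g x - t * (\<Sum>i<m. D i x))\<^sup>2 \<partial>M)"
    by simp
  moreover have "2 * t * (m * \<delta>) = 2 * (m * (t * \<delta>))" "t * (m * \<delta>) = m * (t * \<delta>)"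
    by simp_all
  ultimately show False
    using m by linarith
qed

text \<open>The change of rejection probability caused by shift \<open>i\<close> is the correlation
  of \<open>g\<close> with the centred ratio \<open>D i\<close>. Disjoint supports make these
  orthogonal, and the common \<open>s\<close> gives them the common squared norm
  \<open>exp s - 1\<close>.\<close>

lemma ex_indistinguishable_shift:
  fixes h :: "nat \<Rightarrow> nat \<Rightarrow> real" and g :: "(nat \<Rightarrow> real) \<Rightarrow> real"
  assumes fin: "\<And>i. finite (B i)" and supp: "\<And>i j. j \<notin> B i \<Longrightarrow> h i j = 0"
    and disj: "\<And>i k. i \<noteq> k \<Longrightarrow> B i \<inter> B k = {}"
    and norm: "\<And>i. (\<Sum>j\<in>B i. (h i j)\<^sup>2) = s"
    and [measurable]: "g \<in> borel_measurable seq_borel" and g: "\<And>x. 0 \<le> g x" "\<And>x. g x \<le> 1"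
    and "\<delta> > 0"
  shows "\<exists>i. (\<integral>x. g (\<lambda>j. x j + h i j) \<partial>gauss_seq) \<le> (\<integral>x. g x \<partial>gauss_seq) + \<delta>"
proof -
  interpret G: prob_space gauss_seq by (rule prob_space_gauss_seq)
  define D where "D i x = likelihood_ratio (B i) (h i) x - 1" for i x
  have L: "has_bochner_integral gauss_seq (likelihood_ratio (B i) (h i)) 1" for i
    by (rule likelihood_ratio_has_integral[OF fin supp])
  have one: "has_bochner_integral gauss_seq (\<lambda>_. 1 :: real) 1"
    using G.prob_space by (simp add: has_bochner_integral_iff)
  have inner_h: "(\<Sum>j\<in>B k. h k j * h i j) = (if i = k then s else 0)" for i k
  proof (cases "i = k")
    case False
    then have "h i j = 0" if "j \<in> B k" for j
      using disj[OF False] supp[of j i] that by blast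
    then show ?thesis using False by simp
  qed (use norm[of i] in \<open>simp add: power2_eq_square\<close>)
  have int: "integrable gauss_seq (D i)" for i
    unfolding D_def using L[of i] one by (simp add: has_bochner_integral_iff)
  have orth': "has_bochner_integral gauss_seq (\<lambda>x. D i x * D k x)
      (exp (\<Sum>j\<in>B k. h k j * h i j) - 1 - 1 + 1)" for i k
  proof -
    have "(\<lambda>x. D i x * D k x) = (\<lambda>x. likelihood_ratio (B i) (h i) x * likelihood_ratio (B k) (h k) x
        - likelihood_ratio (B i) (h i) x - likelihood_ratio (B k) (h k) x + 1)"
      by (simp add: D_def algebra_simps)
    then show ?thesis
      by (simp only:) (intro has_bochner_integral_add has_bochner_integral_diff L one
        likelihood_ratio_mult_has_integral fin supp)
  qed
  have orth: "has_bochner_integral gauss_seq (\<lambda>x. D i x * D k x) (if i = k then exp s - 1 else 0)"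
    for i k
    using orth'[of i k] inner_h[of k i] by (cases "i = k") simp_all
  have [measurable]: "g \<in> borel_measurable gauss_seq"
    by (simp add: measurable_cong_sets[OF sets_gauss_seq refl])
  obtain i where i: "(\<integral>x. g x * D i x \<partial>gauss_seq) \<le> \<delta>"
    using G.ex_small_correlation_of_orthogonal[where g = g, OF int orth _ g \<open>\<delta> > 0\<close>] by auto
  have int_g: "integrable gauss_seq g"
    by (rule G.integrable_const_bound[where B = 1]) (use g in simp_all)
  have int_gD: "integrable gauss_seq (\<lambda>x. g x * D i x)"
    by (rule integrable_test_mult[where g = g, OF int _ g]) simp
  have "(\<integral>x. g (\<lambda>j. x j + h i j) \<partial>gauss_seq) = (\<integral>x. likelihood_ratio (B i) (h i) x * g x \<partial>gauss_seq)"
    by (rule integral_gauss_seq_shift[OF fin supp]) (use g in simp_all)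
  also have "\<dots> = (\<integral>x. g x + g x * D i x \<partial>gauss_seq)"
    by (simp add: D_def algebra_simps)
  also have "\<dots> = (\<integral>x. g x \<partial>gauss_seq) + (\<integral>x. g x * D i x \<partial>gauss_seq)"
    by (rule Bochner_Integration.integral_add[OF int_g int_gD])
  finally show ?thesis using i by (intro exI[of _ i]) simp
qed

text \<open>Independence makes the joint law of the noise the product of its marginals, so error
  probabilities over any \<open>M\<close> become integrals over \<open>gauss_seq\<close>.\<close>

lemma (in prob_space) integral_iid_std_normal:
  assumes "indep_vars (\<lambda>_. borel) \<xi> UNIV"
    and dist: "\<And>j. distributed M lborel (\<xi> j) (\<lambda>x. ennreal (std_normal_density x))"
    and g: "g \<in> borel_measurable seq_borel"
  shows "(\<integral>\<omega>. g (\<lambda>j. \<xi> j \<omega>) \<partial>M) = (\<integral>x. g x \<partial>gauss_seq :: real)"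
proof -
  have [measurable]: "random_variable borel (\<xi> j)" for j
    using distributed_measurable[OF dist[of j]] by simp
  have "distr M borel (\<xi> j) = gauss" for j
    using distributed_distr_eq_density[OF dist[of j]] by (simp add: distr_cong[of M M borel lborel])
  then have "distr M seq_borel (\<lambda>\<omega> j. \<xi> j \<omega>) = gauss_seq"
    using indep_vars_iff_distr_eq_PiM[of UNIV \<xi> "\<lambda>_. borel"] assms(1) by (simp add: restrict_def)
  then have "(\<integral>x. g x \<partial>gauss_seq) = (\<integral>x. g x \<partial>distr M seq_borel (\<lambda>\<omega> j. \<xi> j \<omega>))"
    by simp
  also have "\<dots> = (\<integral>\<omega>. g (\<lambda>j. \<xi> j \<omega>) \<partial>M)"
    by (rule integral_distr) (use g in \<open>auto intro!: measurable_PiM_single' simp: space_PiM\<close>)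
  finally show ?thesis ..
qed

section \<open>Compactness, norm balls and orthosymmetry in \<open>ell2\<close>\<close>

lemma ell2_norm_sq: "(norm x)\<^sup>2 = (\<Sum>j. (coord x j)\<^sup>2)" for x :: ell2
  by (simp add: norm_ell2_def suminf_nonneg summable_coord_sq)

lemma coord_Abs_ell2: "summable (\<lambda>j. (x j)\<^sup>2) \<Longrightarrow> coord (Abs_ell2 x) = x"
  by (simp add: Abs_ell2_inverse)

text \<open>Tychonoff gives a compact closure \<open>T\<close> of the coordinate sequences in the
  product topology. Uniform tails make \<open>Abs_ell2\<close> continuous from \<open>T\<close> to
  the norm topology, so \<open>U\<close> lies in a compact image.\<close>

lemma compact_closure_if_uniform_tails:
  fixes U :: "ell2 set"
  assumes bound: "\<And>j. \<exists>b. \<forall>\<theta>\<in>U. \<bar>coord \<theta> j\<bar> \<le> b"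
    and tails: "\<And>e. e > 0 \<Longrightarrow> \<exists>m. \<forall>\<theta>\<in>U. \<forall>l. (\<Sum>j\<in>{m..<l}. (coord \<theta> j)\<^sup>2) \<le> e"
  shows "compact (closure U)"
proof -
  obtain b where b: "\<And>j \<theta>. \<theta> \<in> U \<Longrightarrow> \<bar>coord \<theta> j\<bar> \<le> b j"
    using bound by metis
  define T where "T = closure (coord ` U)"
  define box where "box = PiE UNIV (\<lambda>j. {- b j..b j})"
  have "compact box"
    unfolding box_def compactin_euclidean_iff[symmetric] euclidean_product_topology[symmetric]
    by (subst compactin_PiE) simp
  then have "closed box"
    by (rule compact_imp_closed)
  have "coord ` U \<subseteq> box"
    using b by (auto simp: box_def abs_le_iff minus_le_iff)
  have "compact T"
    using \<open>compact box\<close> \<open>closed box\<close> \<open>coord ` U \<subseteq> box\<close> unfolding T_def by (metis closed_closure closure_minimal compact_Int_closed inf.absorb2)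
  have coord_cont [continuous_intros]: "continuous_on A (\<lambda>x. x j :: real)" for j :: nat and A
    by (rule continuous_on_subset[OF continuous_on_product_coordinates]) simp
  \<comment> \<open>Each finite sum is continuous in the product topology, so the tail bounds are
    closed conditions and survive the closure.\<close>
  have tailsT: "\<exists>m. \<forall>x\<in>T. \<forall>l. (\<Sum>j\<in>{m..<l}. (x j)\<^sup>2) \<le> e" if e: "e > 0" for e
  proof -
    obtain m where m: "\<And>\<theta> l. \<theta> \<in> U \<Longrightarrow> (\<Sum>j\<in>{m..<l}. (coord \<theta> j)\<^sup>2) \<le> e"
      using tails[OF e] by blast
    have "T \<subseteq> {x. (\<Sum>j\<in>{m..<l}. (x j)\<^sup>2) \<le> e}" for l
      unfolding T_def
    proof (rule closure_minimal)
      show "closed {x :: nat \<Rightarrow> real. (\<Sum>j\<in>{m..<l}. (x j)\<^sup>2) \<le> e}"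
        by (intro closed_Collect_le continuous_intros)
    qed (use m in auto)
    then show ?thesis by blast
  qed
  \<comment> \<open>Only on square-summable sequences is \<open>Abs_ell2\<close> an inverse of
    \<open>coord\<close>.\<close>
  have summ: "summable (\<lambda>j. (x j)\<^sup>2)" if x: "x \<in> T" for x
  proof -
    obtain m where m: "\<And>l. (\<Sum>j\<in>{m..<l}. (x j)\<^sup>2) \<le> 1"
      using tailsT[of 1] x by auto
    have "(\<Sum>j<l. (x j)\<^sup>2) \<le> (\<Sum>j<m. (x j)\<^sup>2) + 1" for l
    proof -
      have "(\<Sum>j<l. (x j)\<^sup>2) \<le> (\<Sum>j\<in>{..<m} \<union> {m..<l}. (x j)\<^sup>2)"
        by (rule sum_mono2) auto
      also have "\<dots> = (\<Sum>j<m. (x j)\<^sup>2) + (\<Sum>j\<in>{m..<l}. (x j)\<^sup>2)"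
        by (rule sum.union_disjoint) auto
      finally show ?thesis using m[of l] by simp
    qed
    then show ?thesis
      by (intro summableI_nonneg_bounded) simp_all
  qed
  have "continuous_on T Abs_ell2"
    unfolding continuous_on_def
  proof (intro ballI tendstoI)
    fix x and e :: real assume x: "x \<in> T" and e: "e > 0"
    \<comment> \<open>By \<open>(y - x)\<^sup>2 \<le> 2 * y\<^sup>2 + 2 * x\<^sup>2\<close> the tail
      of the difference contributes at most \<open>e\<^sup>2 / 4\<close>. The head, handled by
      coordinatewise convergence, contributes less than another
      \<open>e\<^sup>2 / 4\<close>.\<close>
    obtain m where m: "\<And>y l. y \<in> T \<Longrightarrow> (\<Sum>j\<in>{m..<l}. (y j)\<^sup>2) \<le> e\<^sup>2 / 16"
      using tailsT[of "e\<^sup>2 / 16"] e by auto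
    have "continuous_on T (\<lambda>y. \<Sum>j<m. (y j - x j)\<^sup>2)"
      by (intro continuous_intros)
    then have "((\<lambda>y. \<Sum>j<m. (y j - x j)\<^sup>2) \<longlongrightarrow> (\<Sum>j<m. (x j - x j)\<^sup>2)) (at x within T)"
      using x unfolding continuous_on_def by blast
    then have "\<forall>\<^sub>F y in at x within T. (\<Sum>j<m. (y j - x j)\<^sup>2) < e\<^sup>2 / 4"
      by (rule order_tendstoD) (use e in simp)
    then show "\<forall>\<^sub>F y in at x within T. dist (Abs_ell2 y) (Abs_ell2 x) < e"
      unfolding eventually_at_filter
    proof eventually_elim
      case (elim y)
      show ?case
      proof (intro impI)
        assume "y \<noteq> x" "y \<in> T"
        with elim have y: "y \<in> T" and head: "(\<Sum>j<m. (y j - x j)\<^sup>2) < e\<^sup>2 / 4" by auto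
        have "(\<Sum>j<l. (y j - x j)\<^sup>2) \<le> e\<^sup>2 / 2" for l
        proof -
          have "(\<Sum>j<l. (y j - x j)\<^sup>2) \<le> (\<Sum>j\<in>{..<m} \<union> {m..<l}. (y j - x j)\<^sup>2)"
            by (rule sum_mono2) auto
          also have "\<dots> = (\<Sum>j<m. (y j - x j)\<^sup>2) + (\<Sum>j\<in>{m..<l}. (y j - x j)\<^sup>2)"
            by (rule sum.union_disjoint) auto
          also have "(\<Sum>j\<in>{m..<l}. (y j - x j)\<^sup>2) \<le> (\<Sum>j\<in>{m..<l}. 2 * (y j)\<^sup>2 + 2 * (x j)\<^sup>2)"
          proof (rule sum_mono)
            fix j
            have "0 \<le> (y j + x j)\<^sup>2" by simp
            then show "(y j - x j)\<^sup>2 \<le> 2 * (y j)\<^sup>2 + 2 * (x j)\<^sup>2"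
              by (simp add: power2_sum power2_diff)
          qed
          also have "\<dots> = 2 * (\<Sum>j\<in>{m..<l}. (y j)\<^sup>2) + 2 * (\<Sum>j\<in>{m..<l}. (x j)\<^sup>2)"
            by (simp add: sum.distrib sum_distrib_left)
          finally show ?thesis
            using head m[OF x, of l] m[OF y, of l] by simp
        qed
        then have "(norm (Abs_ell2 y - Abs_ell2 x))\<^sup>2 \<le> e\<^sup>2 / 2"
          unfolding ell2_norm_sq
          using summable_coord_sq[of "Abs_ell2 y - Abs_ell2 x"]
          by (intro suminf_le_const)
            (simp_all add: minus_ell2.rep_eq coord_Abs_ell2 summ x y)
        also have "\<dots> < e\<^sup>2" using e by simp
        finally show "dist (Abs_ell2 y) (Abs_ell2 x) < e"
          using e by (simp add: dist_norm power_less_imp_less_base)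
      qed
    qed
  qed
  then have "compact (Abs_ell2 ` T)"
    by (rule compact_continuous_image) fact
  moreover have "U \<subseteq> Abs_ell2 ` T"
  proof
    fix \<theta> assume "\<theta> \<in> U"
    then have "coord \<theta> \<in> T"
      unfolding T_def by (intro closure_subset[THEN subsetD] imageI)
    then have "Abs_ell2 (coord \<theta>) \<in> Abs_ell2 ` T"
      by (rule imageI)
    then show "\<theta> \<in> Abs_ell2 ` T"
      by (simp add: coord_inverse)
  qed
  ultimately show ?thesis
    by (metis closed_closure closure_minimal compact_Int_closed compact_imp_closed inf.absorb2)
qed

text \<open>Orthosymmetry puts the projection of \<theta> to the j-th axis into the ball, so
  \<open>\<bar>coord \<theta> j\<bar> * N e \<le> r\<close> for the unit vector \<open>e\<close>.
  This ties \<open>N\<close> to single coordinates although \<open>N\<close> is not assumed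
  comparable with the norm of \<open>ell2\<close>.\<close>

lemma coord_bounded_on_norm_ball:
  assumes "banach_space_on S N" and orth: "orthosymmetric {\<theta> \<in> S. N \<theta> \<le> r}"
  shows "\<exists>b. \<forall>\<theta>\<in>{\<theta> \<in> S. N \<theta> \<le> r}. \<bar>coord \<theta> j\<bar> \<le> b"
proof -
  have S: "subspace S"
    using assms(1) by (simp add: banach_space_on_def)
  have N_pos: "0 < N x" if "x \<in> S" "x \<noteq> 0" for x
    using assms(1) that by (simp add: banach_space_on_def order_less_le)
  have N_scale: "N (c *\<^sub>R x) = \<bar>c\<bar> * N x" if "x \<in> S" for x c
    using assms(1) that by (simp add: banach_space_on_def)
  define e where "e = Abs_ell2 (\<lambda>i. if i = j then 1 else 0)"
  have "summable (\<lambda>i. (if i = j then 1 else 0 :: real)\<^sup>2)"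
    by (rule summable_finite[of "{j}"]) auto
  then have e: "coord e = (\<lambda>i. if i = j then 1 else 0)"
    unfolding e_def by (rule coord_Abs_ell2)
  then have "e \<noteq> 0"
    by (metis zero_ell2.rep_eq zero_neq_one)
  have ball: "coord \<theta> j *\<^sub>R e \<in> S \<and> N (coord \<theta> j *\<^sub>R e) \<le> r" if "\<theta> \<in> S" "N \<theta> \<le> r" for \<theta>
  proof -
    have "\<forall>i. \<bar>coord (coord \<theta> j *\<^sub>R e) i\<bar> \<le> \<bar>coord \<theta> i\<bar>"
      by (simp add: scaleR_ell2.rep_eq e)
    then show ?thesis
      using orth that unfolding orthosymmetric_def by blast
  qed
  \<comment> \<open>A nonzero coordinate is what forces \<open>e\<close> into \<open>S\<close>,
    where \<open>N\<close> is known to be positive.\<close>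
  have "\<bar>coord \<theta> j\<bar> \<le> \<bar>r\<bar> / N e" if \<theta>: "\<theta> \<in> S" "N \<theta> \<le> r" "coord \<theta> j \<noteq> 0" for \<theta>
  proof -
    have "e = inverse (coord \<theta> j) *\<^sub>R (coord \<theta> j *\<^sub>R e)"
      using \<theta>(3) by simp
    then have "e \<in> S"
      using ball[OF \<theta>(1,2)] subspace_scale[OF S] by metis
    then have "N e > 0"
      using \<open>e \<noteq> 0\<close> by (rule N_pos)
    moreover have "\<bar>coord \<theta> j\<bar> * N e \<le> \<bar>r\<bar>"
      using ball[OF \<theta>(1,2)] N_scale[OF \<open>e \<in> S\<close>, of "coord \<theta> j"] by linarith
    ultimately show ?thesis
      by (simp add: pos_le_divide_eq)
  qed
  \<comment> \<open>If coordinate \<open>j\<close> vanishes on the whole ball, \<open>e\<close> may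
    lie outside \<open>S\<close> and \<open>N e\<close> may be any real number; the 0 covers this
    case.\<close>
  then have "\<bar>coord \<theta> j\<bar> \<le> max 0 (\<bar>r\<bar> / N e)" if "\<theta> \<in> S" "N \<theta> \<le> r" for \<theta>
    using that by (cases "coord \<theta> j = 0") (auto simp: le_max_iff_disj)
  then show ?thesis by blast
qed

text \<open>A window carrying mass above \<open>e\<close> exists beyond every index. Cutting a
  vector to such a window and shrinking it to mass exactly \<open>e\<close> stays in
  \<open>U\<close> by orthosymmetry; the next window starts where the last one ended.\<close>

lemma orthosymmetric_disjoint_blocks:
  assumes "orthosymmetric U" and "e > 0"
    and tails: "\<And>m. \<exists>\<theta>\<in>U. \<exists>l. e < (\<Sum>j\<in>{m..<l}. (coord \<theta> j)\<^sup>2)"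
  obtains \<theta> :: "nat \<Rightarrow> ell2" and B :: "nat \<Rightarrow> nat set" where "\<And>i. \<theta> i \<in> U" "\<And>i. finite (B i)"
    "\<And>i j. j \<notin> B i \<Longrightarrow> coord (\<theta> i) j = 0" "\<And>i k. i \<noteq> k \<Longrightarrow> B i \<inter> B k = {}"
    "\<And>i. (\<Sum>j\<in>B i. (coord (\<theta> i) j)\<^sup>2) = e"
proof -
  have "\<exists>\<eta> l. \<eta> \<in> U \<and> (\<forall>j. j \<notin> {m..<l} \<longrightarrow> coord \<eta> j = 0) \<and> (\<Sum>j\<in>{m..<l}. (coord \<eta> j)\<^sup>2) = e" for m
  proof -
    obtain \<theta> l where \<theta>: "\<theta> \<in> U" and l: "e < (\<Sum>j\<in>{m..<l}. (coord \<theta> j)\<^sup>2)"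
      using tails by blast
    \<comment> \<open>The window mass exceeds \<open>e\<close>, so this factor is at most 1 and only
      shrinks coordinates.\<close>
    define c where "c = sqrt (e / (\<Sum>j\<in>{m..<l}. (coord \<theta> j)\<^sup>2))"
    have c: "0 \<le> c" "c \<le> 1" "c\<^sup>2 * (\<Sum>j\<in>{m..<l}. (coord \<theta> j)\<^sup>2) = e"
      using l \<open>e > 0\<close> by (simp_all add: c_def)
    define \<eta> where "\<eta> = Abs_ell2 (\<lambda>j. if j \<in> {m..<l} then c * coord \<theta> j else 0)"
    have "summable (\<lambda>j. (if j \<in> {m..<l} then c * coord \<theta> j else 0)\<^sup>2)"
      by (rule summable_finite[of "{m..<l}"]) auto
    then have \<eta>: "coord \<eta> = (\<lambda>j. if j \<in> {m..<l} then c * coord \<theta> j else 0)"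
      unfolding \<eta>_def by (rule coord_Abs_ell2)
    have "\<forall>j. \<bar>coord \<eta> j\<bar> \<le> \<bar>coord \<theta> j\<bar>"
      using c(1,2) by (simp add: \<eta> abs_mult mult_left_le_one_le)
    then have "\<eta> \<in> U"
      using assms(1) \<theta> unfolding orthosymmetric_def by blast
    moreover have "(\<Sum>j\<in>{m..<l}. (coord \<eta> j)\<^sup>2) = e"
      using c(3) by (simp add: \<eta> power_mult_distrib sum_distrib_left)
    ultimately show ?thesis
      by (intro exI[of _ \<eta>] exI[of _ l]) (simp add: \<eta>)
  qed
  then obtain \<eta> l where \<eta>: "\<And>m. \<eta> m \<in> U" "\<And>m j. j \<notin> {m..<l m} \<Longrightarrow> coord (\<eta> m) j = 0"
      "\<And>m. (\<Sum>j\<in>{m..<l m}. (coord (\<eta> m) j)\<^sup>2) = e"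
    by metis
  \<comment> \<open>Iterating \<open>l\<close> from 0 makes \<open>s i\<close> the start of block
    \<open>i\<close> and \<open>s (Suc i)\<close> its excluded end.\<close>
  define s where "s = rec_nat 0 (\<lambda>_. l)"
  have s: "s (Suc i) = l (s i)" for i
    by (simp add: s_def)
  have "m < l m" for m
    using \<eta>(3)[of m] \<open>e > 0\<close> by (cases "m < l m") auto
  then have "incseq s"
    by (intro incseq_SucI) (simp add: s less_imp_le)
  then have lt: "{s i..<l (s i)} \<inter> {s k..<l (s k)} = {}" if "i < k" for i k
    using incseqD[of s "Suc i" k] that by (auto simp: s)
  show ?thesis
  proof (rule that[of "\<lambda>i. \<eta> (s i)" "\<lambda>i. {s i..<l (s i)}"])
    show "{s i..<l (s i)} \<inter> {s k..<l (s k)} = {}" if "i \<noteq> k" for i k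
      using lt[of i k] lt[of k i] that by (cases "i < k") auto
  qed (use \<eta> in auto)
qed

section \<open>Lower bound for the sum of the errors when tails are not uniformly small\<close>

theorem theorem3p1:
  fixes M :: "'w measure" and \<xi> :: "nat \<Rightarrow> 'w \<Rightarrow> real" and \<sigma> :: real
    and S :: "ell2 set" and N :: "ell2 \<Rightarrow> real" and r :: real
    and U :: "ell2 set" and \<rho> :: "nat \<Rightarrow> real"
  assumes "prob_space M"
    and "prob_space.indep_vars M (\<lambda>_. borel) \<xi> UNIV"
    and "\<And>j. distributed M lborel (\<xi> j) (\<lambda>x. ennreal (std_normal_density x))"
    and "\<sigma> > 0"
    and "banach_space_on S N"
    and "r > 0"
    and "U = {\<theta> \<in> S. N \<theta> \<le> r}"
    and "convex U"
    and "orthosymmetric U"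
    and "\<And>n. n \<ge> 1 \<Longrightarrow> \<rho> n > 0"
    and "\<rho> \<longlonglongrightarrow> 0"
    and "consistent_tests_exist M \<xi> \<sigma> (alternatives U \<rho>)"
  shows "relatively_compact U"
  unfolding relatively_compact_def
proof (rule compact_closure_if_uniform_tails)
  show "\<exists>b. \<forall>\<theta>\<in>U. \<bar>coord \<theta> j\<bar> \<le> b" for j
    using coord_bounded_on_norm_ball[OF assms(5)] assms(9) unfolding assms(7) by blast
next
  fix e :: real assume e: "e > 0"
  show "\<exists>m. \<forall>\<theta>\<in>U. \<forall>l. (\<Sum>j\<in>{m..<l}. (coord \<theta> j)\<^sup>2) \<le> e"
  proof (rule ccontr)
    interpret prob_space M by fact
    assume "\<not> ?thesis"
    then have "\<exists>\<theta>\<in>U. \<exists>l. e < (\<Sum>j\<in>{m..<l}. (coord \<theta> j)\<^sup>2)" for m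
      by (meson not_le)
    then obtain \<theta> :: "nat \<Rightarrow> ell2" and B :: "nat \<Rightarrow> nat set"
      where \<theta>: "\<And>i. \<theta> i \<in> U" and B: "\<And>i. finite (B i)" "\<And>i j. j \<notin> B i \<Longrightarrow> coord (\<theta> i) j = 0"
        "\<And>i k. i \<noteq> k \<Longrightarrow> B i \<inter> B k = {}" "\<And>i. (\<Sum>j\<in>B i. (coord (\<theta> i) j)\<^sup>2) = e"
      using orthosymmetric_disjoint_blocks[OF assms(9) e] by metis
    have norm_\<theta>: "norm (\<theta> i) = sqrt e" for i
      unfolding norm_ell2_def using suminf_finite[OF B(1)[of i], of "\<lambda>j. (coord (\<theta> i) j)\<^sup>2"] B(2,4)
      by simp
    obtain K where K: "\<And>n. n \<ge> 1 \<Longrightarrow> is_test (K n)" and limsup: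
        "limsup (\<lambda>n. ennreal (type1_error M \<xi> \<sigma> n (K n))
          + sup_type2_error M \<xi> \<sigma> n (K n) (alternatives U \<rho> n)) < 1"
      using assms(12) unfolding consistent_tests_exist_def by blast
    have "\<forall>\<^sub>F n in sequentially. \<rho> n < sqrt e"
      by (rule order_tendstoD(2)[OF assms(11)]) (use e in simp)
    \<comment> \<open>For large \<open>n\<close> three facts meet: the error sum is below 1, the
      noise level is positive, and every \<open>\<theta> i\<close> is an alternative. They are
      contradictory for each single such \<open>n\<close>.\<close>
    with Limsup_lessD[OF limsup] eventually_ge_at_top[of 1]
    have "\<forall>\<^sub>F n :: nat in sequentially. False"
    proof eventually_elim
      case (elim n)
      define \<tau> where "\<tau> = \<sigma> / sqrt (real n)"
      have \<tau>: "\<tau> > 0"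
        using elim assms(4) by (simp add: \<tau>_def)
      \<comment> \<open>The test in standardized coordinates: dividing the observations by \<tau>
        gives standard noise shifted by \<open>coord \<theta> j / \<tau>\<close>.\<close>
      define g where "g x = K n (\<lambda>j. \<tau> * x j)" for x
      have g: "0 \<le> g x" "g x \<le> 1" for x
        using K[of n] elim by (auto simp: g_def is_test_def)
      have [measurable]: "K n \<in> borel_measurable seq_borel"
        using K[of n] elim by (simp add: is_test_def)
      have g_meas [measurable]: "g \<in> borel_measurable seq_borel"
      proof -
        have "(\<lambda>x j. \<tau> * x j) \<in> seq_borel \<rightarrow>\<^sub>M seq_borel"
          by (rule measurable_PiM_single') (simp_all add: space_PiM)
        then show ?thesis unfolding g_def by measurable
      qed
      define a where "a = (\<integral>x. g x \<partial>gauss_seq)"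
      define b where "b i = (\<integral>x. g (\<lambda>j. x j + coord (\<theta> i) j / \<tau>) \<partial>gauss_seq)" for i
      have type1: "type1_error M \<xi> \<sigma> n (K n) = a"
        unfolding a_def integral_iid_std_normal[OF assms(2,3) g_meas, symmetric]
        by (simp add: type1_error_def observation_def g_def zero_ell2.rep_eq \<tau>_def)
      have type2: "type2_error M \<xi> \<sigma> n (K n) (\<theta> i) = 1 - b i" for i
      proof -
        interpret G: prob_space gauss_seq by (rule prob_space_gauss_seq)
        have meas [measurable]: "(\<lambda>x. g (\<lambda>j. x j + coord (\<theta> i) j / \<tau>)) \<in> borel_measurable seq_borel"
          by measurable
        have "type2_error M \<xi> \<sigma> n (K n) (\<theta> i)
            = (\<integral>\<omega>. 1 - g (\<lambda>j. \<xi> j \<omega> + coord (\<theta> i) j / \<tau>) \<partial>M)"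
          using \<tau> by (simp add: type2_error_def observation_def g_def \<tau>_def[symmetric] algebra_simps)
        also have "\<dots> = (\<integral>x. 1 - g (\<lambda>j. x j + coord (\<theta> i) j / \<tau>) \<partial>gauss_seq)"
          by (rule integral_iid_std_normal[OF assms(2,3)]) measurable
        also have "\<dots> = 1 - b i"
        proof -
          have "integrable gauss_seq (\<lambda>x. g (\<lambda>j. x j + coord (\<theta> i) j / \<tau>))"
            by (rule G.integrable_const_bound[where B = 1]) (use g in simp_all)
          then show ?thesis
            using G.prob_space by (simp add: b_def)
        qed
        finally show ?thesis .
      qed
      have "1 \<le> ennreal a + sup_type2_error M \<xi> \<sigma> n (K n) (alternatives U \<rho> n)"
      proof (rule ennreal_le_epsilon)
        fix \<delta> :: real assume "\<delta> > 0"
        \<comment> \<open>With \<open>n\<close> fixed, \<tau> does not depend on \<open>i\<close>,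
          so the rescaled shifts still share one squared norm.\<close>
        have "(\<Sum>j\<in>B i. (coord (\<theta> i) j / \<tau>)\<^sup>2) = e / \<tau>\<^sup>2" for i
          by (simp add: power_divide sum_divide_distrib[symmetric] B(4))
        then obtain i where i: "b i \<le> a + \<delta>"
          using ex_indistinguishable_shift[of B "\<lambda>i j. coord (\<theta> i) j / \<tau>", OF B(1) _ B(3) _ g_meas g \<open>\<delta> > 0\<close>]
            B(2) unfolding a_def b_def by auto
        have "\<theta> i \<in> alternatives U \<rho> n"
          using elim \<theta> by (simp add: alternatives_def norm_\<theta>)
        then have "ennreal (1 - b i) \<le> sup_type2_error M \<xi> \<sigma> n (K n) (alternatives U \<rho> n)"
          unfolding sup_type2_error_def type2[symmetric] by (rule SUP_upper)
        have "0 \<le> a"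
          using g by (simp add: a_def)
        have "(1::ennreal) = ennreal 1" by simp
        \<comment> \<open>\<open>ennreal\<close> sends negative reals to 0, and \<open>max 0\<close>
          mirrors this truncation.\<close>
        also have "\<dots> \<le> ennreal (a + max 0 (1 - b i) + \<delta>)"
          using i by (intro ennreal_leI) simp
        also have "\<dots> = ennreal a + ennreal (1 - b i) + ennreal \<delta>"
          using \<open>0 \<le> a\<close> \<open>\<delta> > 0\<close> by (cases "b i \<le> 1") (simp_all add: ennreal_neg)
        also have "\<dots> \<le> ennreal a + sup_type2_error M \<xi> \<sigma> n (K n) (alternatives U \<rho> n) + ennreal \<delta>"
          by (intro add_mono order_refl) fact
        finally show "1 \<le> ennreal a + sup_type2_error M \<xi> \<sigma> n (K n) (alternatives U \<rho> n) + ennreal \<delta>" .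
      qed
      with elim show False
        by (simp add: type1 not_less[symmetric])
    qed
    then show False by simp
  qed
qed

end
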